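(* Let $\mathcal{A}$ be a unit associative algebra over $\mathbb{K}\in\{\mathbb{R},\mathbb{C}\}$. An evolvable parallelogram net $p=(p^1,\dots,p^n):\vec{\mathcal{E}}(\mathbb{Z}^n)\to\mathcal{A}$ satisfies, for all $i\neq j$ at every vertex, $$p^i_j=(p^j-p^i)\,p^i\,(p^j-p^i)^{-1}.$$
   Context: $\vec{\mathcal{E}}(\mathbb{Z}^n)$ is the set of directed edges $(x,x+e_i)$ of $\mathbb{Z}^n$. An edge based map $p=(p^1,\dots,p^n)$ assigns $p^i(x)$ to the edge $(x,x+e_i)$; write $p^i=p^i(x)$ and $p^i_j=p^i(x+e_j)$. A parallelogram net is an edge based map such that on every quad $$p^i+p^j_i=p^j+p^i_j,\qquad p^j_ip^i=p^i_jp^j.$$ It is evolvable if $p^j-p^i$ is invertible for all $i\neq j$ at every vertex. *)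

theory Defs
  imports "HOL-Analysis.Finite_Cartesian_Product"
begin

text \<open>
  The sort \<open>{ring, monoid_mult}\<close> is used instead of \<open>ring_1\<close> because the latter excludes
  the zero algebra.
\<close>

locale unital_algebra = vector_space scale
  for scale :: "'k::field \<Rightarrow> 'a::{ring, monoid_mult} \<Rightarrow> 'a" +
  assumes mult_scale_left: "scale c a * b = scale c (a * b)"
    and mult_scale_right: "a * scale c b = scale c (a * b)"

definition invertible_elem :: "'a::monoid_mult \<Rightarrow> bool" where
  "invertible_elem a \<longleftrightarrow> (\<exists>b. a * b = 1 \<and> b * a = 1)"

text \<open>Meaningful only for invertible elements; the inverse is then unique.\<close>

definition inv_elem :: "'a::monoid_mult \<Rightarrow> 'a" where
  "inv_elem a = (THE b. a * b = 1 \<and> b * a = 1)"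

definition unit_vec :: "'n::finite \<Rightarrow> int ^ 'n" where
  "unit_vec i = axis i 1"

definition directed_edges :: "((int ^ 'n) \<times> (int ^ 'n)) set" where
  "directed_edges = {(x, x + unit_vec i) | x i. True}"

text \<open>
  An edge based map is a function on pairs of vertices of which only the values on
  \<open>directed_edges\<close> are ever used: \<open>edge_val p i x\<close> is $p^i(x)$, and hence
  \<open>edge_val p i (x + unit_vec j)\<close> is $p^i_j$ at the vertex \<open>x\<close>.
\<close>

definition edge_val :: "((int ^ 'n) \<times> (int ^ 'n) \<Rightarrow> 'a) \<Rightarrow> 'n::finite \<Rightarrow> int ^ 'n \<Rightarrow> 'a" where
  "edge_val p i x = p (x, x + unit_vec i)"

lemma edge_in_directed_edges: "(x, x + unit_vec i) \<in> directed_edges"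
  by (auto simp: directed_edges_def)

definition parallelogram_net ::
  "((int ^ 'n::finite) \<times> (int ^ 'n) \<Rightarrow> 'a::{ring, monoid_mult}) \<Rightarrow> bool" where
  "parallelogram_net p \<longleftrightarrow> (\<forall>x i j. i \<noteq> j \<longrightarrow>
     edge_val p i x + edge_val p j (x + unit_vec i)
       = edge_val p j x + edge_val p i (x + unit_vec j) \<and>
     edge_val p j (x + unit_vec i) * edge_val p i x
       = edge_val p i (x + unit_vec j) * edge_val p j x)"

definition evolvable ::
  "((int ^ 'n::finite) \<times> (int ^ 'n) \<Rightarrow> 'a::{ring, monoid_mult}) \<Rightarrow> bool" where
  "evolvable p \<longleftrightarrow> (\<forall>x i j. i \<noteq> j \<longrightarrow> invertible_elem (edge_val p j x - edge_val p i x))"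

end

theory Submission
  imports Defs
begin

text \<open>On a quad, the additive relation makes the difference of the two edges at
  \<open>x\<close> equal to that of the opposite edges: p^j - p^i = p^j_i - p^i_j. Multiplying by
  p^i on the right and replacing p^j_i p^i by p^i_j p^j gives the intertwining relation (p^j - p^i)
  p^i = p^i_j (p^j - p^i). Evolvability allows cancelling the right factor.\<close>

text \<open>Since \<open>inv_elem\<close> is a definite description, this rests on the uniqueness of
  two-sided inverses: c = c(ab) = (ca)b = b.\<close>

lemma mult_inv_elem_right:
  assumes "invertible_elem (a::'a::monoid_mult)"
  shows "a * inv_elem a = 1"
proof -
  obtain b where b: "a * b = 1" "b * a = 1"
    using assms unfolding invertible_elem_def by blast
  have "inv_elem a = b"
    unfolding inv_elem_def
  proof (rule the_equality)
    fix c assume c: "a * c = 1 \<and> c * a = 1"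
    have "c = c * (a * b)" using b by simp
    also have "\<dots> = b" using c by (simp flip: mult.assoc)
    finally show "c = b" .
  qed (use b in simp)
  with b show ?thesis by simp
qed

theorem proposition2p3:
  fixes p :: "(int ^ 'n::finite) \<times> (int ^ 'n) \<Rightarrow> 'a::{ring, monoid_mult}"
  assumes "(\<exists>scale :: real \<Rightarrow> 'a \<Rightarrow> 'a. unital_algebra scale) \<or>
           (\<exists>scale :: complex \<Rightarrow> 'a \<Rightarrow> 'a. unital_algebra scale)"
    and "parallelogram_net p"
    and "evolvable p"
  shows "\<forall>x i j. i \<noteq> j \<longrightarrow>
           edge_val p i (x + unit_vec j)
             = (edge_val p j x - edge_val p i x) * edge_val p i x
                 * inv_elem (edge_val p j x - edge_val p i x)"
proof (intro allI impI)
  fix x i and j :: 'n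
  assume "i \<noteq> j"
  \<comment> \<open>In the quad at \<open>x\<close>, \<open>d\<close> lies opposite \<open>a\<close>
    and \<open>c\<close> opposite \<open>b\<close>.\<close>
  define a b c d where "a = edge_val p i x" and "b = edge_val p j x"
    and "c = edge_val p j (x + unit_vec i)" and "d = edge_val p i (x + unit_vec j)"
  have add: "a + c = b + d" and mult: "c * a = d * b"
    using assms(2) \<open>i \<noteq> j\<close> unfolding parallelogram_net_def a_def b_def c_def d_def by blast+
  have "invertible_elem (b - a)"
    using assms(3) \<open>i \<noteq> j\<close> unfolding evolvable_def a_def b_def by blast
  then have inv: "(b - a) * inv_elem (b - a) = 1"
    by (rule mult_inv_elem_right)
  have "b - a = c - d"
    using add by (simp add: algebra_simps)
  then have "(b - a) * a = (c - d) * a"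
    by simp
  \<comment> \<open>After expanding, \<open>mult\<close> turns \<open>c * a\<close> into
    \<open>d * b\<close>, so \<open>d\<close> factors out on the left.\<close>
  also have "\<dots> = d * (b - a)"
    using mult by (simp add: left_diff_distrib right_diff_distrib)
  finally have "(b - a) * a * inv_elem (b - a) = d"
    using inv by (simp add: mult.assoc)
  then show "edge_val p i (x + unit_vec j)
      = (edge_val p j x - edge_val p i x) * edge_val p i x
          * inv_elem (edge_val p j x - edge_val p i x)"
    unfolding a_def b_def d_def by simp
qed

end
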